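(* For any multisegment $\mathbf a$ there exist a symmetric multisegment $\mathbf a^{\mathrm{sym}}$ and three multisegments $\mathbf c_1,\mathbf c_2,\mathbf c_3$ such that $$\mathbf a^{\mathrm{sym}}\in{}_{\mathbf c_2,\mathbf c_3}S(\mathbf a^{\mathrm{sym}})_{\mathbf c_1},\qquad \mathbf a={}^{(\mathbf c_2,\mathbf c_3)}(\mathbf a^{\mathrm{sym}})^{(\mathbf c_1)} .$$
   Context: Segments and multisegments. A segment is a set $\Delta=[i,j]=\{i,\dots,j\}$ with $i\le j$ integers; $b(\Delta)=i$, $e(\Delta)=j$. A multisegment is a finite multiset of segments (empty segments are discarded; the empty multisegment is allowed); its degree $\deg$ is the sum of the cardinalities of its segments. Two segments are linked if their union is a segment different from both. An elementary operation replaces a linked pair $\Delta,\Delta'$ by $\Delta\cup\Delta'$ and $\Delta\cap\Delta'$ (omitted if empty). $\mathbf b\le\mathbf a$ means $\mathbf b$ is obtained from $\mathbf a$ by a (possibly empty) sequence of elementary operations; $S(\mathbf a)=\{\mathbf b:\mathbf b\le\mathbf a\}$. Total order on segments: $[j,k]\prec[m,n]$ if $k<n$, or if $k=n$ and $j>m$. A multisegment $\{\Delta_1,\dots,\Delta_n\}$ is symmetric if the $b(\Delta_i)$ are pairwise distinct, the $e(\Delta_i)$ are pairwise distinct, and $\max_i b(\Delta_i)\le\min_i e(\Delta_i)$. Right truncation. $\Delta^{(k)}=[b(\Delta),k-1]$ if $e(\Delta)=k$ (empty if $\Delta=[k,k]$), and $\Delta^{(k)}=\Delta$ otherwise; $\mathbf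 a^{(k)}=\{\Delta^{(k)}:\Delta\in\mathbf a\}$. $S(\mathbf a)_k$ is the set of $\mathbf c\in S(\mathbf a)$ with $\deg(\mathbf c^{(k)})=\deg(\mathbf a^{(k)})$ and such that $\mathbf c$ contains no pair of linked segments $\Delta,\Delta'$ with $e(\Delta)=k-1$, $e(\Delta')=k$. For a sequence $(k_1,\dots,k_r)$, $\mathbf a^{(k_1,\dots,k_r)}=(\cdots(\mathbf a^{(k_1)})\cdots)^{(k_r)}$, and $S(\mathbf a)_{k_1,\dots,k_r}$ is the set of $\mathbf c\in S(\mathbf a)$ with $\mathbf c^{(k_1,\dots,k_{i-1})}\in S(\mathbf a^{(k_1,\dots,k_{i-1})})_{k_i}$ for $i=1,\dots,r$. For a multisegment $\mathbf d=\{\Delta_1\preceq\cdots\preceq\Delta_r\}$, $\Delta_i=[k_i,\ell_i]$, the notations $\mathbf a^{(\mathbf d)}$ and $S(\mathbf a)_{\mathbf d}$ refer to the sequence $(k_r,k_r+1,\dots,\ell_r,\,k_{r-1},\dots,\ell_{r-1},\,\dots,\,k_1,\dots,\ell_1)$, applied from left to right. Left truncation. ${}^{(k)}\Delta=[k+1,e(\Delta)]$ if $b(\Delta)=k$ (empty if $\Delta=[k,k]$), and ${}^{(k)}\Delta=\Delta$ otherwise; ${}^{(k)}\mathbf a=\{{}^{(k)}\Delta:\Delta\in\mathbf a\}$. ${}_kS(\mathbf a)$ is the set of $\mathbf c\in S(\mathbf a)$ with $\deg({}^{(k)}\mathbf c)=\deg({}^{(k)}\mathbf a)$ and such that $\mathbf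 c$ contains no pair of linked segments $\Delta,\Delta'$ with $b(\Delta)=k$, $b(\Delta')=k+1$. For a sequence, ${}^{(k_r,\dots,k_1)}\mathbf a$ is obtained by applying ${}^{(k_1)}$ first, then ${}^{(k_2)}$, etc., and ${}_{k_r,\dots,k_1}S(\mathbf a)$ is the set of $\mathbf c\in S(\mathbf a)$ with ${}^{(k_{i-1},\dots,k_1)}\mathbf c\in{}_{k_i}S({}^{(k_{i-1},\dots,k_1)}\mathbf a)$ for $i=1,\dots,r$. For a multisegment $\mathbf d=\{\Delta_1,\dots,\Delta_r\}$, $\Delta_i=[k_i,\ell_i]$, listed with $k_1\le\cdots\le k_r$, the notations ${}^{(\mathbf d)}\mathbf a$ and ${}_{\mathbf d}S(\mathbf a)$ refer to the sequence $k_r,\dots,\ell_r,\,\dots,\,k_1,\dots,\ell_1$ (the rightmost index is applied first). Combination. ${}^{(\mathbf c_2,\mathbf c_3)}\mathbf d^{(\mathbf c_1)}=\big({}^{(\mathbf c_2)}({}^{(\mathbf c_3)}\mathbf d)\big)^{(\mathbf c_1)}$. The set ${}_{\mathbf c_2,\mathbf c_3}S(\mathbf a)_{\mathbf c_1}$ consists of the $\mathbf d\in S(\mathbf a)$ with $\mathbf d\in{}_{\mathbf c_3}S(\mathbf a)$, ${}^{(\mathbf c_3)}\mathbf d\in{}_{\mathbf c_2}S({}^{(\mathbf c_3)}\mathbf a)$ and ${}^{(\mathbf c_2)}({}^{(\mathbf c_3)}\mathbf d)\in S\big({}^{(\mathbf c_2)}({}^{(\mathbf c_3)}\mathbf a)\big)_{\mathbf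 c_1}$. *)

theory Defs
  imports Main "HOL-Library.Multiset"
begin

definition segment :: "int set \<Rightarrow> bool" where
  "segment \<Delta> \<longleftrightarrow> (\<exists>i j. i \<le> j \<and> \<Delta> = {i..j})"

definition seg_b :: "int set \<Rightarrow> int" where
  "seg_b \<Delta> = Min \<Delta>"

definition seg_e :: "int set \<Rightarrow> int" where
  "seg_e \<Delta> = Max \<Delta>"

definition multisegment :: "int set multiset \<Rightarrow> bool" where
  "multisegment a \<longleftrightarrow> (\<forall>\<Delta>\<in>#a. segment \<Delta>)"

definition mdeg :: "int set multiset \<Rightarrow> nat" where
  "mdeg a = (\<Sum>\<Delta>\<in>#a. card \<Delta>)"

definition discard_empty :: "int set multiset \<Rightarrow> int set multiset" where
  "discard_empty a = filter_mset (\<lambda>\<Delta>. \<Delta> \<noteq> {}) a"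

definition linked :: "int set \<Rightarrow> int set \<Rightarrow> bool" where
  "linked \<Delta> \<Delta>' \<longleftrightarrow> segment (\<Delta> \<union> \<Delta>') \<and> \<Delta> \<union> \<Delta>' \<noteq> \<Delta> \<and> \<Delta> \<union> \<Delta>' \<noteq> \<Delta>'"

definition elem_op :: "int set multiset \<Rightarrow> int set multiset \<Rightarrow> bool" where
  "elem_op a b \<longleftrightarrow> (\<exists>\<Delta> \<Delta>' r. linked \<Delta> \<Delta>' \<and> a = {#\<Delta>, \<Delta>'#} + r \<and>
     b = discard_empty {#\<Delta> \<union> \<Delta>', \<Delta> \<inter> \<Delta>'#} + r)"

definition mseg_le :: "int set multiset \<Rightarrow> int set multiset \<Rightarrow> bool" where
  "mseg_le b a \<longleftrightarrow> elem_op\<^sup>*\<^sup>* a b"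

definition S :: "int set multiset \<Rightarrow> int set multiset set" where
  "S a = {b. mseg_le b a}"

definition seg_less :: "int set \<Rightarrow> int set \<Rightarrow> bool" where
  "seg_less \<Delta> \<Delta>' \<longleftrightarrow> seg_e \<Delta> < seg_e \<Delta>' \<or> (seg_e \<Delta> = seg_e \<Delta>' \<and> seg_b \<Delta> > seg_b \<Delta>')"

definition seg_le :: "int set \<Rightarrow> int set \<Rightarrow> bool" where
  "seg_le \<Delta> \<Delta>' \<longleftrightarrow> seg_less \<Delta> \<Delta>' \<or> \<Delta> = \<Delta>'"

text \<open>The empty multisegment counts as symmetric.\<close>

definition symmetric :: "int set multiset \<Rightarrow> bool" where
  "symmetric a \<longleftrightarrow> multisegment a \<and>
     (\<forall>x. count (image_mset seg_b a) x \<le> 1) \<and>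
     (\<forall>x. count (image_mset seg_e a) x \<le> 1) \<and>
     (a \<noteq> {#} \<longrightarrow> Max (seg_b ` set_mset a) \<le> Min (seg_e ` set_mset a))"


section \<open>Right truncation\<close>

definition rtrunc_seg :: "int \<Rightarrow> int set \<Rightarrow> int set" where
  "rtrunc_seg k \<Delta> = (if seg_e \<Delta> = k then {seg_b \<Delta>..k - 1} else \<Delta>)"

definition rtrunc :: "int \<Rightarrow> int set multiset \<Rightarrow> int set multiset" where
  "rtrunc k a = discard_empty (image_mset (rtrunc_seg k) a)"

definition S_right :: "int \<Rightarrow> int set multiset \<Rightarrow> int set multiset set" where
  "S_right k a = {c \<in> S a. mdeg (rtrunc k c) = mdeg (rtrunc k a) \<and>
     \<not> (\<exists>\<Delta> \<Delta>'. \<Delta> \<in># c \<and> \<Delta>' \<in># c \<and> linked \<Delta> \<Delta>' \<and> seg_e \<Delta> = k - 1 \<and> seg_e \<Delta>' = k)}"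

definition rtrunc_seq :: "int list \<Rightarrow> int set multiset \<Rightarrow> int set multiset" where
  "rtrunc_seq ks a = fold rtrunc ks a"

definition S_right_seq :: "int list \<Rightarrow> int set multiset \<Rightarrow> int set multiset set" where
  "S_right_seq ks a = {c \<in> S a. \<forall>i<length ks.
     rtrunc_seq (take i ks) c \<in> S_right (ks ! i) (rtrunc_seq (take i ks) a)}"


section \<open>Left truncation\<close>

definition ltrunc_seg :: "int \<Rightarrow> int set \<Rightarrow> int set" where
  "ltrunc_seg k \<Delta> = (if seg_b \<Delta> = k then {k + 1..seg_e \<Delta>} else \<Delta>)"

definition ltrunc :: "int \<Rightarrow> int set multiset \<Rightarrow> int set multiset" where
  "ltrunc k a = discard_empty (image_mset (ltrunc_seg k) a)"

definition S_left :: "int \<Rightarrow> int set multiset \<Rightarrow> int set multiset set" where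
  "S_left k a = {c \<in> S a. mdeg (ltrunc k c) = mdeg (ltrunc k a) \<and>
     \<not> (\<exists>\<Delta> \<Delta>'. \<Delta> \<in># c \<and> \<Delta>' \<in># c \<and> linked \<Delta> \<Delta>' \<and> seg_b \<Delta> = k \<and> seg_b \<Delta>' = k + 1)}"

text \<open>In contrast to right truncation, the last index of the list is applied first.\<close>

definition ltrunc_seq :: "int list \<Rightarrow> int set multiset \<Rightarrow> int set multiset" where
  "ltrunc_seq ks a = foldr ltrunc ks a"

definition S_left_seq :: "int list \<Rightarrow> int set multiset \<Rightarrow> int set multiset set" where
  "S_left_seq ks a = {c \<in> S a. \<forall>i<length ks.
     ltrunc_seq (drop (Suc i) ks) c \<in> S_left (ks ! i) (ltrunc_seq (drop (Suc i) ks) a)}"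


section \<open>Truncation by a multisegment\<close>

text \<open>
  Truncation by a multisegment depends on an enumeration
  \<open>[\<Delta>\<^sub>1, \<dots>, \<Delta>\<^sub>r]\<close> of it. For right truncation the enumeration
  increases for the total order \<open>seg_le\<close> and is therefore unique. For left truncation it
  is only required that the beginnings increase weakly; segments with the same beginning may come
  in any order, and the truncation can depend on that order. The notions below therefore take the
  enumeration as argument.
\<close>

definition right_listing :: "int set multiset \<Rightarrow> int set list \<Rightarrow> bool" where
  "right_listing d \<Delta>s \<longleftrightarrow> mset \<Delta>s = d \<and> sorted_wrt seg_le \<Delta>s"

definition left_listing :: "int set multiset \<Rightarrow> int set list \<Rightarrow> bool" where
  "left_listing d \<Delta>s \<longleftrightarrow> mset \<Delta>s = d \<and> sorted_wrt (\<lambda>\<Delta> \<Delta>'. seg_b \<Delta> \<le> seg_b \<Delta>') \<Delta>s"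

text \<open>For \<open>\<Delta>\<^sub>i = [k\<^sub>i, l\<^sub>i]\<close> this is
  \<open>k\<^sub>r, \<dots>, l\<^sub>r, \<dots>, k\<^sub>1, \<dots>, l\<^sub>1\<close>.\<close>

definition index_seq :: "int set list \<Rightarrow> int list" where
  "index_seq \<Delta>s = concat (map (\<lambda>\<Delta>. [seg_b \<Delta>..seg_e \<Delta>]) (rev \<Delta>s))"

definition rtrunc_by :: "int set list \<Rightarrow> int set multiset \<Rightarrow> int set multiset" where
  "rtrunc_by \<Delta>s a = rtrunc_seq (index_seq \<Delta>s) a"

definition S_right_by :: "int set list \<Rightarrow> int set multiset \<Rightarrow> int set multiset set" where
  "S_right_by \<Delta>s a = S_right_seq (index_seq \<Delta>s) a"

definition ltrunc_by :: "int set list \<Rightarrow> int set multiset \<Rightarrow> int set multiset" where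
  "ltrunc_by \<Delta>s a = ltrunc_seq (index_seq \<Delta>s) a"

definition S_left_by :: "int set list \<Rightarrow> int set multiset \<Rightarrow> int set multiset set" where
  "S_left_by \<Delta>s a = S_left_seq (index_seq \<Delta>s) a"

definition trunc_by ::
  "int set list \<Rightarrow> int set list \<Rightarrow> int set multiset \<Rightarrow> int set list \<Rightarrow> int set multiset" where
  "trunc_by C2 C3 d C1 = rtrunc_by C1 (ltrunc_by C2 (ltrunc_by C3 d))"

definition S_by ::
  "int set list \<Rightarrow> int set list \<Rightarrow> int set multiset \<Rightarrow> int set list \<Rightarrow> int set multiset set" where
  "S_by C2 C3 a C1 = {d \<in> S a. d \<in> S_left_by C3 a \<and>
     ltrunc_by C3 d \<in> S_left_by C2 (ltrunc_by C3 a) \<and>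
     ltrunc_by C2 (ltrunc_by C3 d) \<in> S_right_by C1 (ltrunc_by C2 (ltrunc_by C3 a))}"


section \<open>Enumerations exist\<close>

lemma segment_eq: "segment \<Delta> \<Longrightarrow> \<Delta> = {seg_b \<Delta>..seg_e \<Delta>}"
proof -
  assume "segment \<Delta>"
  then obtain i j where ij: "i \<le> j" "\<Delta> = {i..j}"
    unfolding segment_def by blast
  have "Min {i..j} = i" "Max {i..j} = j"
    using ij(1) by (auto intro: Min_eqI Max_eqI)
  then show ?thesis
    using ij by (simp add: seg_b_def seg_e_def)
qed

lemma seg_le_trans: "seg_le x y \<Longrightarrow> seg_le y z \<Longrightarrow> seg_le x z"
  by (auto simp: seg_le_def seg_less_def)

lemma seg_le_total:
  assumes "segment x" "segment y" "\<not> seg_le x y"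
  shows "seg_le y x"
  using segment_eq[OF assms(1)] segment_eq[OF assms(2)] assms(3)
  by (metis linorder_neqE_linordered_idom seg_le_def seg_less_def)

lemma left_listing_exists: "\<exists>\<Delta>s. left_listing d \<Delta>s"
proof -
  obtain xs where xs: "mset xs = d"
    using ex_mset by blast
  have "sorted (map seg_b (sort_key seg_b xs))"
    by simp
  then have "left_listing d (sort_key seg_b xs)"
    using xs by (simp add: left_listing_def sorted_wrt_map del: sorted_sort_key)
  then show ?thesis
    by blast
qed

lemma right_listing_exists: "multisegment d \<Longrightarrow> \<exists>\<Delta>s. right_listing d \<Delta>s"
proof (induction d)
  case empty
  then show ?case
    by (auto simp: right_listing_def)
next
  case (add x d)
  then obtain xs where xs: "mset xs = d" "sorted_wrt seg_le xs"
    by (auto simp: multisegment_def right_listing_def)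
  let ?ys = "filter (\<lambda>y. seg_le y x) xs @ x # filter (\<lambda>y. \<not> seg_le y x) xs"
  have ge: "seg_le x y" if "y \<in> set xs" "\<not> seg_le y x" for y
    using that add.prems xs(1) seg_le_total[of y x] by (auto simp: multisegment_def)
  have "sorted_wrt seg_le ?ys"
    using xs(2) ge by (auto simp: sorted_wrt_append sorted_wrt_filter intro: seg_le_trans)
  moreover have "mset ?ys = add_mset x d"
    using xs(1) by (simp add: mset_filter flip: multiset_partition)
  ultimately show ?case
    unfolding right_listing_def by blast
qed

end

theory Submission
  imports Defs
begin

text \<open>
  The sequence attached to a segment \<open>[k, l]\<close> lowers every end in \<open>[k, l]\<close> by one, and only its
  first step can meet a forbidden linked pair: afterwards no segment has its end just below the
  next index. List \<open>a\<close> as \<open>\<Delta>\<^sub>0 \<preceq> \<Delta>\<^sub>1 \<preceq> \<dots>\<close> and lengthen \<open>\<Delta>\<^sub>j\<close> on the right by \<open>D + j + 1\<close>.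
  The ends are then pairwise distinct, and for large \<open>D\<close> they exceed all beginnings. Lowering first
  all ends \<open>D\<close> times, and then the ends from index \<open>j\<close> on, for \<open>j = 0, 1, \<dots>\<close>, restores \<open>a\<close>;
  when \<open>\<Delta>\<^sub>j\<close> joins segments with the same end, the order \<open>\<preceq>\<close> says that it is
  the longest of them, so nothing is linked. Giving the truncating segments pairwise distinct ends
  makes their listing unique. The reflection \<open>x \<mapsto> -x\<close> turns this into a statement on left
  truncation, which makes the beginnings distinct; one left truncation suffices, so
  \<open>c\<^sub>2\<close> is empty.
\<close>

section \<open>Segments and reflection\<close>

lemma seg_b_atLeastAtMost [simp]: "i \<le> j \<Longrightarrow> seg_b {i..j} = i"
  by (auto simp: seg_b_def intro: Min_eqI)

lemma seg_e_atLeastAtMost [simp]: "i \<le> j \<Longrightarrow> seg_e {i..j} = j"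
  by (auto simp: seg_e_def intro: Max_eqI)

lemma segment_atLeastAtMost [simp]: "i \<le> j \<Longrightarrow> segment {i..j}"
  by (auto simp: segment_def)

lemma segmentE:
  assumes "segment \<Delta>"
  obtains i j where "i \<le> j" "\<Delta> = {i..j}"
  using assms by (auto simp: segment_def)

lemma S_refl [simp]: "a \<in> S a"
  by (simp add: S_def mseg_le_def)

definition reflect :: "int set multiset \<Rightarrow> int set multiset" where
  "reflect a = image_mset ((`) uminus) a"

lemma image_uminus_image_uminus [simp]: "uminus ` uminus ` (A :: int set) = A"
  by (simp add: image_image)

lemma image_uminus_eq_iff [simp]: "uminus ` A = uminus ` B \<longleftrightarrow> A = (B :: int set)"
  by (metis image_uminus_image_uminus)

lemma reflect_reflect [simp]: "reflect (reflect a) = a"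
  by (simp add: reflect_def multiset.map_comp comp_def)

lemma segment_image_uminus [simp]: "segment (uminus ` \<Delta>) \<longleftrightarrow> segment \<Delta>"
proof -
  have "segment (uminus ` \<Delta>)" if "segment \<Delta>" for \<Delta>
    using that by (auto elim!: segmentE)
  from this[of \<Delta>] this[of "uminus ` \<Delta>"] show ?thesis
    by auto
qed

lemma seg_b_image_uminus: "segment \<Delta> \<Longrightarrow> seg_b (uminus ` \<Delta>) = - seg_e \<Delta>"
  by (auto elim!: segmentE)

lemma seg_e_image_uminus: "segment \<Delta> \<Longrightarrow> seg_e (uminus ` \<Delta>) = - seg_b \<Delta>"
  by (auto elim!: segmentE)

lemma multisegment_reflect [simp]: "multisegment (reflect a) \<longleftrightarrow> multisegment a"
  by (simp add: multisegment_def reflect_def)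

lemma linked_image_uminus: "linked (uminus ` \<Delta>) (uminus ` \<Delta>') \<longleftrightarrow> linked \<Delta> \<Delta>'"
  by (simp add: linked_def flip: image_Un)

lemma linked_commute: "linked \<Delta> \<Delta>' \<longleftrightarrow> linked \<Delta>' \<Delta>"
  by (auto simp: linked_def Un_commute)

lemma rtrunc_seg_image_uminus:
  "segment \<Delta> \<Longrightarrow> rtrunc_seg (- k) (uminus ` \<Delta>) = uminus ` ltrunc_seg k \<Delta>"
  by (auto elim!: segmentE simp: rtrunc_seg_def ltrunc_seg_def)

lemma multisegment_ltrunc: "multisegment a \<Longrightarrow> multisegment (ltrunc k a)"
  by (auto simp: multisegment_def ltrunc_def discard_empty_def ltrunc_seg_def
      intro!: segment_atLeastAtMost)

lemma rtrunc_reflect: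
  assumes "multisegment a"
  shows "rtrunc (- k) (reflect a) = reflect (ltrunc k a)"
proof -
  have "image_mset (rtrunc_seg (- k)) (reflect a)
      = image_mset ((`) uminus) (image_mset (ltrunc_seg k) a)"
    using assms
    by (auto simp: reflect_def multiset.map_comp comp_def multisegment_def
        rtrunc_seg_image_uminus intro!: image_mset_cong)
  then show ?thesis
    by (simp add: rtrunc_def ltrunc_def reflect_def discard_empty_def
        filter_mset_image_mset)
qed

text \<open>Compared with itself, \<open>c\<close> meets the order and degree conditions by
  reflexivity. Every membership in the theorem has this form, so only linked pairs have to be
  excluded.\<close>

lemma self_S_right_iff: "c \<in> S_right k c \<longleftrightarrow>
    \<not> (\<exists>\<Delta> \<Delta>'. \<Delta> \<in># c \<and> \<Delta>' \<in># c \<and> linked \<Delta> \<Delta>' \<and> seg_e \<Delta> = k - 1 \<and> seg_e \<Delta>' = k)"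
  by (simp add: S_right_def)

lemma self_S_left_iff: "c \<in> S_left k c \<longleftrightarrow>
    \<not> (\<exists>\<Delta> \<Delta>'. \<Delta> \<in># c \<and> \<Delta>' \<in># c \<and> linked \<Delta> \<Delta>' \<and> seg_b \<Delta> = k \<and> seg_b \<Delta>' = k + 1)"
  by (simp add: S_left_def)

lemma reflect_self_S_right_iff:
  assumes "multisegment a"
  shows "reflect a \<in> S_right (- k) (reflect a) \<longleftrightarrow> a \<in> S_left k a"
proof -
  have seg: "segment \<Delta>" if "\<Delta> \<in># a" for \<Delta>
    using assms that by (simp add: multisegment_def)
  have "(\<exists>\<Delta> \<Delta>'. \<Delta> \<in># reflect a \<and> \<Delta>' \<in># reflect a \<and> linked \<Delta> \<Delta>' \<and>
          seg_e \<Delta> = - k - 1 \<and> seg_e \<Delta>' = - k)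
      \<longleftrightarrow> (\<exists>\<Delta>\<in>#a. \<exists>\<Delta>'\<in>#a. linked (uminus ` \<Delta>) (uminus ` \<Delta>') \<and>
          seg_e (uminus ` \<Delta>) = - k - 1 \<and> seg_e (uminus ` \<Delta>') = - k)"
    by (auto simp: reflect_def)
  also have "\<dots> \<longleftrightarrow> (\<exists>\<Delta>\<in>#a. \<exists>\<Delta>'\<in>#a. linked \<Delta> \<Delta>' \<and> seg_b \<Delta> = k + 1 \<and> seg_b \<Delta>' = k)"
    by (intro bex_cong refl) (auto simp: seg seg_e_image_uminus linked_image_uminus)
  \<comment> \<open>Negation reverses the pair; symmetry of \<open>linked\<close> restores its
    order.\<close>
  also have "\<dots> \<longleftrightarrow> (\<exists>\<Delta> \<Delta>'. \<Delta> \<in># a \<and> \<Delta>' \<in># a \<and> linked \<Delta> \<Delta>' \<and> seg_b \<Delta> = k \<and> seg_b \<Delta>' = k + 1)"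
    using linked_commute by blast
  finally show ?thesis
    by (simp add: self_S_right_iff self_S_left_iff)
qed

section \<open>Sequences of truncations\<close>

lemma self_S_right_seq_Nil [simp]: "a \<in> S_right_seq [] a"
  by (simp add: S_right_seq_def)

text \<open>When \<open>a\<close> is its own reference, each intermediate truncation is again
  compared with itself, which turns the condition over prefixes into a recursion.\<close>

lemma self_S_right_seq_Cons: "a \<in> S_right_seq (k # ks) a \<longleftrightarrow>
    a \<in> S_right k a \<and> rtrunc k a \<in> S_right_seq ks (rtrunc k a)"
  by (simp add: S_right_seq_def rtrunc_seq_def All_less_Suc2)

lemma self_S_right_seq_append: "a \<in> S_right_seq (ks @ ks') a \<longleftrightarrow>
    a \<in> S_right_seq ks a \<and> rtrunc_seq ks a \<in> S_right_seq ks' (rtrunc_seq ks a)"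
  by (induction ks arbitrary: a) (auto simp: self_S_right_seq_Cons rtrunc_seq_def)

text \<open>The last index acts first, so the recursion peels off the end of the list; this is why
  reflection has to reverse \<open>ks\<close> below.\<close>

lemma self_S_left_seq_snoc: "a \<in> S_left_seq (ks @ [k]) a \<longleftrightarrow>
    a \<in> S_left k a \<and> ltrunc k a \<in> S_left_seq ks (ltrunc k a)"
  by (auto simp: S_left_seq_def ltrunc_seq_def nth_append All_less_Suc)

lemma reflect_self_S_right_seq_iff:
  "multisegment a \<Longrightarrow>
    reflect a \<in> S_right_seq (map uminus (rev ks)) (reflect a) \<longleftrightarrow> a \<in> S_left_seq ks a"
proof (induction ks arbitrary: a rule: rev_induct)
  case Nil
  then show ?case
    by (simp add: S_left_seq_def)
next
  case (snoc k ks)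
  then show ?case
    by (simp add: self_S_right_seq_Cons self_S_left_seq_snoc reflect_self_S_right_iff
        rtrunc_reflect multisegment_ltrunc)
qed

lemma rtrunc_seq_reflect:
  "multisegment a \<Longrightarrow>
    rtrunc_seq (map uminus (rev ks)) (reflect a) = reflect (ltrunc_seq ks a)"
  unfolding rtrunc_seq_def ltrunc_seq_def
  by (induction ks arbitrary: a rule: rev_induct) (simp_all add: rtrunc_reflect multisegment_ltrunc)

lemma map_uminus_rev_upto: "map uminus (rev [i..j]) = [- j..- i]"
proof (rule map_sorted_distinct_set_unique[where f = id])
  show "sorted (map id (map uminus (rev [i..j])))"
    using sorted_upto[of i j] by (simp add: sorted_wrt_map sorted_wrt_rev)
  show "distinct (map id (map uminus (rev [i..j])))"
    by (simp add: distinct_map)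
  show "set (map uminus (rev [i..j])) = set [- j..- i]"
    by simp
qed simp_all

text \<open>Negation turns increasing ends into decreasing beginnings, and the inner
  \<open>rev\<close> makes them increasing, as a left listing requires. The outer \<open>rev\<close>
  accounts for left truncation reading its indices from the right.\<close>

lemma map_uminus_rev_index_seq:
  assumes "\<forall>\<Gamma>\<in>set \<Gamma>s. segment \<Gamma>"
  shows "map uminus (rev (index_seq (rev (map ((`) uminus) \<Gamma>s)))) = index_seq \<Gamma>s"
  using assms
proof (induction \<Gamma>s)
  case Nil
  then show ?case
    by (simp add: index_seq_def)
next
  case (Cons \<Gamma> \<Gamma>s)
  then show ?case
    using map_uminus_rev_upto[of "- seg_e \<Gamma>" "- seg_b \<Gamma>"]
    by (simp add: index_seq_def seg_b_image_uminus seg_e_image_uminus)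
qed

section \<open>Lowering a range of ends\<close>

text \<open>Right truncation moves only ends, so \<open>b\<close> stays fixed while \<open>f\<close>
  changes, and the index follows each segment through the sequence.\<close>

definition mseg :: "(nat \<Rightarrow> int) \<Rightarrow> (nat \<Rightarrow> int) \<Rightarrow> nat \<Rightarrow> int set multiset" where
  "mseg b f n = mset (map (\<lambda>i. {b i..f i}) [0..<n])"

lemma mseg_cong: "(\<And>i. i < n \<Longrightarrow> f i = g i) \<Longrightarrow> mseg b f n = mseg b g n"
  by (auto simp: mseg_def intro!: image_mset_cong)

lemma in_mseg_iff: "\<Delta> \<in># mseg b f n \<longleftrightarrow> (\<exists>i<n. \<Delta> = {b i..f i})"
  by (auto simp: mseg_def)

lemma image_seg_b_mseg:
  "(\<And>i. i < n \<Longrightarrow> b i \<le> f i) \<Longrightarrow> image_mset seg_b (mseg b f n) = mset (map b [0..<n])"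
  by (auto simp: mseg_def multiset.map_comp comp_def intro!: image_mset_cong)

lemma image_seg_e_mseg:
  "(\<And>i. i < n \<Longrightarrow> b i \<le> f i) \<Longrightarrow> image_mset seg_e (mseg b f n) = mset (map f [0..<n])"
  by (auto simp: mseg_def multiset.map_comp comp_def intro!: image_mset_cong)

text \<open>The second hypothesis keeps truncated segments nonempty, so nothing is discarded and the
  indexing survives.\<close>

lemma rtrunc_mseg:
  assumes "\<And>i. i < n \<Longrightarrow> b i \<le> f i" "\<And>i. i < n \<Longrightarrow> f i = k \<Longrightarrow> b i < k"
  shows "rtrunc k (mseg b f n) = mseg b (\<lambda>i. if f i = k then k - 1 else f i) n"
proof -
  have "image_mset (rtrunc_seg k) (mseg b f n) = mseg b (\<lambda>i. if f i = k then k - 1 else f i) n"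
    using assms
    by (auto simp: mseg_def multiset.map_comp comp_def rtrunc_seg_def intro!: image_mset_cong)
  moreover have "{} \<notin># mseg b (\<lambda>i. if f i = k then k - 1 else f i) n"
  proof
    assume "{} \<in># mseg b (\<lambda>i. if f i = k then k - 1 else f i) n"
    then obtain i where "i < n" "\<not> b i \<le> (if f i = k then k - 1 else f i)"
      by (auto simp: in_mseg_iff simp del: if_split)
    then show False
      using assms[of i] by (auto split: if_splits)
  qed
  ultimately show ?thesis
    by (auto simp: rtrunc_def discard_empty_def filter_mset_eq_conv)
qed

text \<open>By the second hypothesis a segment ending at \<open>k - 1\<close> lies inside every
  segment ending at \<open>k\<close>, and nested segments are not linked.\<close>

lemma self_S_right_mseg:
  assumes "\<And>i. i < n \<Longrightarrow> b i \<le> f i"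
    and "\<And>i j. i < n \<Longrightarrow> j < n \<Longrightarrow> f i = k - 1 \<Longrightarrow> f j = k \<Longrightarrow> b j \<le> b i"
  shows "mseg b f n \<in> S_right k (mseg b f n)"
proof -
  have False
    if ij: "i < n" "j < n" and l: "linked {b i..f i} {b j..f j}"
      and e: "seg_e {b i..f i} = k - 1" "seg_e {b j..f j} = k" for i j
  proof -
    have "f i = k - 1" "f j = k"
      using e assms(1)[OF ij(1)] assms(1)[OF ij(2)] by simp_all
    moreover from this have "b j \<le> b i"
      using assms(2) ij by simp
    ultimately have "{b i..f i} \<union> {b j..f j} = {b j..f j}"
      by auto
    with l show False
      by (simp add: linked_def)
  qed
  then show ?thesis
    by (auto simp: self_S_right_iff in_mseg_iff)
qed

lemma rtrunc_range_mseg: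
  assumes "\<And>i. i < n \<Longrightarrow> b i \<le> f i"
    and "\<And>i. i < n \<Longrightarrow> k \<le> f i \<Longrightarrow> f i \<le> l \<Longrightarrow> b i < f i"
    and "\<And>i j. i < n \<Longrightarrow> j < n \<Longrightarrow> f i = k - 1 \<Longrightarrow> f j = k \<Longrightarrow> b j \<le> b i"
  shows "mseg b f n \<in> S_right_seq [k..l] (mseg b f n) \<and>
    rtrunc_seq [k..l] (mseg b f n) = mseg b (\<lambda>i. if k \<le> f i \<and> f i \<le> l then f i - 1 else f i) n"
  using assms
proof (induction k l arbitrary: f rule: upto.induct)
  case (1 k l)
  show ?case
  proof (cases "k \<le> l")
    case False
    then show ?thesis
      by (auto simp: rtrunc_seq_def intro!: mseg_cong)
  next
    case True
    let ?g = "\<lambda>i. if f i = k then k - 1 else f i"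
    have t: "rtrunc k (mseg b f n) = mseg b ?g n"
      using 1(2,3) True by (intro rtrunc_mseg) fastforce+
    have IH: "mseg b ?g n \<in> S_right_seq [k + 1..l] (mseg b ?g n) \<and>
      rtrunc_seq [k + 1..l] (mseg b ?g n)
        = mseg b (\<lambda>i. if k + 1 \<le> ?g i \<and> ?g i \<le> l then ?g i - 1 else ?g i) n"
    proof (rule 1(1)[OF True])
      show "b i \<le> ?g i" if "i < n" for i
        using 1(2)[OF that] 1(3)[OF that] True by auto
      show "b i < ?g i" if "i < n" "k + 1 \<le> ?g i" "?g i \<le> l" for i
        using 1(3)[OF that(1)] that by (auto split: if_splits)
      \<comment> \<open>No value of \<open>?g\<close> equals \<open>k\<close>, so this case cannot
        occur.\<close>
      show "b j \<le> b i" if "i < n" "j < n" "?g i = k + 1 - 1" "?g j = k + 1" for i j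
        using that by (auto split: if_splits)
    qed
    \<comment> \<open>Ends equal to \<open>k\<close> have dropped to \<open>k - 1\<close>, outside
      the remaining range, so no end drops twice.\<close>
    have "mseg b (\<lambda>i. if k + 1 \<le> ?g i \<and> ?g i \<le> l then ?g i - 1 else ?g i) n
        = mseg b (\<lambda>i. if k \<le> f i \<and> f i \<le> l then f i - 1 else f i) n"
      using True by (intro mseg_cong) auto
    moreover have "mseg b f n \<in> S_right k (mseg b f n)"
      using 1(2,4) by (rule self_S_right_mseg)
    ultimately show ?thesis
      using True IH t by (simp add: upto_rec1 self_S_right_seq_Cons rtrunc_seq_def)
  qed
qed

text \<open>\<open>F t\<close> holds the ends just before range \<open>t\<close> is applied; the
  last hypothesis says that this range leads to \<open>F (Suc t)\<close>.\<close>

lemma rtrunc_ranges_mseg: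
  fixes F :: "nat \<Rightarrow> nat \<Rightarrow> int"
  assumes "\<And>t i. t < T \<Longrightarrow> i < n \<Longrightarrow> b i \<le> F t i"
    and "\<And>t i. t < T \<Longrightarrow> i < n \<Longrightarrow> k t \<le> F t i \<Longrightarrow> F t i \<le> l t \<Longrightarrow> b i < F t i"
    and "\<And>t i j. t < T \<Longrightarrow> i < n \<Longrightarrow> j < n \<Longrightarrow> F t i = k t - 1 \<Longrightarrow> F t j = k t \<Longrightarrow> b j \<le> b i"
    and "\<And>t i. t < T \<Longrightarrow> i < n \<Longrightarrow>
      F (Suc t) i = (if k t \<le> F t i \<and> F t i \<le> l t then F t i - 1 else F t i)"
  shows "mseg b (F 0) n \<in> S_right_seq (concat (map (\<lambda>t. [k t..l t]) [0..<T])) (mseg b (F 0) n) \<and>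
    rtrunc_seq (concat (map (\<lambda>t. [k t..l t]) [0..<T])) (mseg b (F 0) n) = mseg b (F T) n"
  using assms
proof (induction T)
  case 0
  then show ?case
    by (simp add: rtrunc_seq_def)
next
  case (Suc T)
  have "mseg b (F T) n \<in> S_right_seq [k T..l T] (mseg b (F T) n) \<and>
    rtrunc_seq [k T..l T] (mseg b (F T) n)
      = mseg b (\<lambda>i. if k T \<le> F T i \<and> F T i \<le> l T then F T i - 1 else F T i) n"
    by (rule rtrunc_range_mseg) (use Suc.prems(1-3)[of T] in blast)+
  moreover have "mseg b (\<lambda>i. if k T \<le> F T i \<and> F T i \<le> l T then F T i - 1 else F T i) n
      = mseg b (F (Suc T)) n"
    using Suc.prems(4) by (intro mseg_cong) auto
  moreover have "mseg b (F 0) n \<in> S_right_seq (concat (map (\<lambda>t. [k t..l t]) [0..<T])) (mseg b (F 0) n) \<and>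
    rtrunc_seq (concat (map (\<lambda>t. [k t..l t]) [0..<T])) (mseg b (F 0) n) = mseg b (F T) n"
    by (rule Suc.IH) (rule Suc.prems[OF less_SucI]; assumption)+
  ultimately show ?case
    by (simp add: self_S_right_seq_append) (simp add: rtrunc_seq_def)
qed

section \<open>Making ends and beginnings distinct\<close>

text \<open>Numbering along the total order makes each segment contain all earlier ones with the
  same end; this later excludes linked pairs.\<close>

lemma multisegment_eq_mseg:
  assumes "multisegment a"
  obtains b e n where "a = mseg b e n" "\<And>i. i < n \<Longrightarrow> b i \<le> e i"
    "\<And>i j. i < j \<Longrightarrow> j < n \<Longrightarrow> e i < e j \<or> e i = e j \<and> b j \<le> b i"
proof -
  obtain \<Delta>s where \<Delta>s: "mset \<Delta>s = a" "sorted_wrt seg_le \<Delta>s"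
    using right_listing_exists[OF assms] by (auto simp: right_listing_def)
  have seg: "segment (\<Delta>s ! i)" if "i < length \<Delta>s" for i
    using assms \<Delta>s(1) that by (metis multisegment_def nth_mem_mset)
  let ?b = "\<lambda>i. seg_b (\<Delta>s ! i)" and ?e = "\<lambda>i. seg_e (\<Delta>s ! i)"
  have "map (\<lambda>i. {?b i..?e i}) [0..<length \<Delta>s] = \<Delta>s"
    by (rule nth_equalityI) (simp_all add: seg flip: segment_eq)
  then have "a = mseg ?b ?e (length \<Delta>s)"
    using \<Delta>s(1) by (simp only: mseg_def)
  moreover have "?b i \<le> ?e i" if "i < length \<Delta>s" for i
    using seg[OF that] by (auto elim!: segmentE)
  moreover have "?e i < ?e j \<or> ?e i = ?e j \<and> ?b j \<le> ?b i" if "i < j" "j < length \<Delta>s" for i j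
    using sorted_wrt_nth_less[OF \<Delta>s(2) that] by (auto simp: seg_le_def seg_less_def)
  ultimately show thesis
    by (rule that)
qed

lemma count_mset_le_1_iff: "(\<forall>x. count (mset xs) x \<le> 1) \<longleftrightarrow> distinct xs"
  by (metis distinct_count_atmost_1 less_one linorder_not_le nle_le set_mset_mset
      count_eq_zero_iff order_refl zero_le_one)

text \<open>Meant to be used twice, the second time after reflection: preserving the beginnings
  keeps the distinctness gained by the first use.\<close>

lemma ex_rtrunc_distinct_ends:
  assumes "multisegment a"
  obtains a' \<Gamma>s where "multisegment a'" "image_mset seg_b a' = image_mset seg_b a"
    "\<forall>x. count (image_mset seg_e a') x \<le> 1"
    "\<And>\<Delta> \<Delta>'. \<Delta> \<in># a' \<Longrightarrow> \<Delta>' \<in># a' \<Longrightarrow> seg_b \<Delta> \<le> seg_e \<Delta>'"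
    "\<forall>\<Gamma>\<in>set \<Gamma>s. segment \<Gamma>" "sorted_wrt (\<lambda>\<Gamma> \<Gamma>'. seg_e \<Gamma> < seg_e \<Gamma>') \<Gamma>s"
    "a' \<in> S_right_by \<Gamma>s a'" "rtrunc_by \<Gamma>s a' = a"
proof (cases "a = {#}")
  case True
  show thesis
    by (rule that[of "{#}" "[]"])
       (simp_all add: True multisegment_def S_right_by_def rtrunc_by_def index_seq_def rtrunc_seq_def)
next
  case False
  obtain b e n where a: "a = mseg b e n" and be: "\<And>i. i < n \<Longrightarrow> b i \<le> e i"
    and ord: "\<And>i j. i < j \<Longrightarrow> j < n \<Longrightarrow> e i < e j \<or> e i = e j \<and> b j \<le> b i"
    using multisegment_eq_mseg[OF assms] by blast
  have n: "n > 0"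
    using False a by (cases n) (auto simp: mseg_def)
  have e_mono: "e i \<le> e j" if "i \<le> j" "j < n" for i j
    using ord[of i j] that by (cases "i = j") auto
  obtain M where M: "\<And>i. i < n \<Longrightarrow> b i \<le> M"
    using finite_imageI[of "{..<n}" b] by (meson Max_ge finite_lessThan imageI lessThan_iff)
  \<comment> \<open>\<open>e 0\<close> is the least end, so lengthening by at least \<open>D\<close>
    brings every end up to the bound \<open>M\<close> on the beginnings.\<close>
  define D where "D = nat (M - e 0)"
  \<comment> \<open>The subtraction is on naturals: the surplus \<open>D + 1 + j\<close> drops by
    one per range and stops at 0.\<close>
  define F where "F = (\<lambda>t j. e j + int (D + 1 + j - t))"
  \<comment> \<open>Range \<open>t\<close> must move exactly the indices from \<open>t - D\<close>
    on, hence all of them while \<open>t \<le> D\<close>. Earlier segments are restored by then,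
    with ends at most \<open>e (t - D)\<close>.\<close>
  define k where "k = (\<lambda>t. e (t - D) + 1)"
  \<comment> \<open>For \<open>t < T\<close> this is \<open>F t (n - 1)\<close>, the largest current
    end. It strictly decreases in \<open>t\<close>, so the reversed list \<open>\<Gamma>s\<close>
    has strictly increasing ends.\<close>
  define l where "l = (\<lambda>t. e (n - 1) + int (D + n) - int t)"
  define T where "T = D + n"
  define a' where "a' = mseg b (F 0) n"
  define \<Gamma>s where "\<Gamma>s = map (\<lambda>t. {k t..l t}) (rev [0..<T])"
  have F_ge: "b i \<le> F t i" if "i < n" for t i
    using be[OF that] by (simp add: F_def)
  have kl: "k t \<le> l t" if "t < T" for t
  proof -
    have "e (t - D) \<le> e (n - 1)"
      using that n by (intro e_mono) (auto simp: T_def)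
    then show ?thesis
      using that by (simp add: k_def l_def T_def)
  qed
  have chain: "a' \<in> S_right_seq (concat (map (\<lambda>t. [k t..l t]) [0..<T])) a' \<and>
    rtrunc_seq (concat (map (\<lambda>t. [k t..l t]) [0..<T])) a' = mseg b (F T) n"
    unfolding a'_def
  proof (rule rtrunc_ranges_mseg)
    fix t i
    assume t: "t < T" and i: "i < n"
    show "b i \<le> F t i"
      using i by (rule F_ge)
    have above: "e (t - D) \<le> e j" if "t \<le> D + j" "j < n" for j
      using that by (intro e_mono) auto
    have below: "e j \<le> e (t - D)" if "\<not> t \<le> D + j" for j
      using that t by (intro e_mono) (auto simp: T_def)
    have lo: "k t \<le> F t j \<longleftrightarrow> t \<le> D + j" if "j < n" for j
      using above[OF _ that] below[of j] by (cases "t \<le> D + j") (simp_all add: k_def F_def)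
    have hi: "F t i \<le> l t" if "t \<le> D + i"
    proof -
      have "e i \<le> e (n - 1)"
        using i by (intro e_mono) auto
      then show ?thesis
        using that i by (simp add: F_def l_def)
    qed
    show "F (Suc t) i = (if k t \<le> F t i \<and> F t i \<le> l t then F t i - 1 else F t i)"
      using lo[OF i] hi by (auto simp: F_def)
    show "b i < F t i" if "k t \<le> F t i"
      using lo[OF i] that be[OF i] by (simp add: F_def)
    fix j
    assume j: "j < n" and Fi: "F t i = k t - 1" and Fj: "F t j = k t"
    \<comment> \<open>Segment \<open>i\<close> is restored while \<open>j\<close> still has positive
      surplus. As \<open>e j\<close> is at least \<open>e (t - D)\<close>, that surplus is 1 and
      both original ends equal \<open>e (t - D)\<close>; since \<open>i < j\<close>, the order
      compares the beginnings.\<close>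
    have ti: "\<not> t \<le> D + i" and tj: "t \<le> D + j"
      using lo[OF i] lo[OF j] Fi Fj by simp_all
    have "e i = e (t - D)"
      using Fi ti by (simp add: F_def k_def)
    moreover have "e j = e (t - D)"
      using Fj tj above[OF tj j] by (simp add: F_def k_def)
    ultimately show "b j \<le> b i"
      using ord[OF _ j, of i] ti tj by simp
  qed
  have idx: "index_seq \<Gamma>s = concat (map (\<lambda>t. [k t..l t]) [0..<T])"
    unfolding index_seq_def \<Gamma>s_def using kl
    by (auto simp: rev_map comp_def intro!: arg_cong[where f = concat])
  have end_a: "mseg b (F T) n = a"
    unfolding a by (rule mseg_cong) (simp add: F_def T_def)
  have inj: "inj_on (F 0) {0..<n}"
  proof (rule linorder_inj_onI')
    show "F 0 i \<noteq> F 0 j" if "i \<in> {0..<n}" "j \<in> {0..<n}" "i < j" for i j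
      using e_mono[of i j] that by (simp add: F_def)
  qed
  show thesis
  proof (rule that[of a' \<Gamma>s])
    show "multisegment a'"
      using F_ge by (auto simp: multisegment_def a'_def in_mseg_iff)
    show "image_mset seg_b a' = image_mset seg_b a"
      using F_ge be by (simp add: a'_def a image_seg_b_mseg)
    show "\<forall>x. count (image_mset seg_e a') x \<le> 1"
    proof -
      have "image_mset seg_e a' = mset (map (F 0) [0..<n])"
        unfolding a'_def using F_ge by (rule image_seg_e_mseg)
      moreover have "distinct (map (F 0) [0..<n])"
        using inj by (simp add: distinct_map)
      ultimately show ?thesis
        using count_mset_le_1_iff by metis
    qed
    show "seg_b \<Delta> \<le> seg_e \<Delta>'" if "\<Delta> \<in># a'" "\<Delta>' \<in># a'" for \<Delta> \<Delta>'
    proof -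
      obtain i j where ij: "i < n" "\<Delta> = {b i..F 0 i}" "j < n" "\<Delta>' = {b j..F 0 j}"
        using \<open>\<Delta> \<in># a'\<close> \<open>\<Delta>' \<in># a'\<close> by (auto simp: a'_def in_mseg_iff)
      have "b i \<le> F 0 j"
        using M[OF ij(1)] e_mono[OF le0 ij(3)] by (simp add: F_def D_def)
      then show ?thesis
        using ij F_ge by simp
    qed
    show "\<forall>\<Gamma>\<in>set \<Gamma>s. segment \<Gamma>"
      using kl by (auto simp: \<Gamma>s_def)
    show "sorted_wrt (\<lambda>\<Gamma> \<Gamma>'. seg_e \<Gamma> < seg_e \<Gamma>') \<Gamma>s"
      unfolding \<Gamma>s_def sorted_wrt_map sorted_wrt_rev
      by (rule sorted_wrt_mono_rel[OF _ sorted_wrt_upt]) (use kl in \<open>auto simp: l_def\<close>)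
    show "a' \<in> S_right_by \<Gamma>s a'" "rtrunc_by \<Gamma>s a' = a"
      using chain end_a by (simp_all add: S_right_by_def rtrunc_by_def idx)
  qed
qed

text \<open>Distinctness of the keys passes from \<open>ys\<close> to \<open>xs\<close> through the
  multiset of keys, so no ties are left to order. This pins down every listing over which the
  theorem quantifies.\<close>

lemma sorted_key_unique:
  fixes f :: "'a \<Rightarrow> int"
  assumes "mset xs = mset ys" "sorted_wrt (\<lambda>x y. f x \<le> f y) xs" "sorted_wrt (\<lambda>x y. f x < f y) ys"
  shows "xs = ys"
proof -
  have "distinct (map f ys)"
    using assms(3) by (simp add: strict_sorted_iff flip: sorted_wrt_map)
  moreover have "sorted (map f ys)"
    using assms(3) by (simp add: strict_sorted_iff flip: sorted_wrt_map)
  moreover have "sorted (map f xs)"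
    using assms(2) by (simp add: sorted_wrt_map)
  moreover have "mset (map f xs) = mset (map f ys)"
    using assms(1) by simp
  then have "distinct (map f xs)"
    using \<open>distinct (map f ys)\<close> by (metis mset_eq_imp_distinct_iff)
  ultimately show ?thesis
    using assms(1) by (intro map_sorted_distinct_set_unique[where f = f])
      (auto simp: distinct_map dest: mset_eq_setD)
qed

theorem corollary6p11:
  fixes a :: "int set multiset"
  assumes "multisegment a"
  shows "\<exists>asym c1 c2 c3.
    symmetric asym \<and> multisegment c1 \<and> multisegment c2 \<and> multisegment c3 \<and>
    (\<forall>C1 C2 C3. right_listing c1 C1 \<and> left_listing c2 C2 \<and> left_listing c3 C3 \<longrightarrow>
      asym \<in> S_by C2 C3 asym C1 \<and> a = trunc_by C2 C3 asym C1)"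
proof -
  obtain a' \<Gamma>s where a': "multisegment a'" "\<forall>x. count (image_mset seg_e a') x \<le> 1"
    and \<Gamma>s: "\<forall>\<Gamma>\<in>set \<Gamma>s. segment \<Gamma>" "sorted_wrt (\<lambda>\<Gamma> \<Gamma>'. seg_e \<Gamma> < seg_e \<Gamma>') \<Gamma>s"
    and right: "a' \<in> S_right_by \<Gamma>s a'" "rtrunc_by \<Gamma>s a' = a"
    using ex_rtrunc_distinct_ends[OF assms] by metis
  \<comment> \<open>Separating the ends of the reflection separates the beginnings of
    \<open>a'\<close>.\<close>
  obtain a'' \<Theta>s where a'': "multisegment a''" "image_mset seg_b a'' = image_mset seg_b (reflect a')"
      "\<forall>x. count (image_mset seg_e a'') x \<le> 1"
    and le: "\<And>\<Delta> \<Delta>'. \<Delta> \<in># a'' \<Longrightarrow> \<Delta>' \<in># a'' \<Longrightarrow> seg_b \<Delta> \<le> seg_e \<Delta>'"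
    and \<Theta>s: "\<forall>\<Gamma>\<in>set \<Theta>s. segment \<Gamma>" "sorted_wrt (\<lambda>\<Gamma> \<Gamma>'. seg_e \<Gamma> < seg_e \<Gamma>') \<Theta>s"
    and right': "a'' \<in> S_right_by \<Theta>s a''" "rtrunc_by \<Theta>s a'' = reflect a'"
    using ex_rtrunc_distinct_ends[of "reflect a'"] a'(1) by (metis multisegment_reflect)
  let ?asym = "reflect a''"
  let ?C3 = "rev (map ((`) uminus) \<Theta>s)"
  have seg_b: "image_mset seg_b (reflect c) = image_mset uminus (image_mset seg_e c)"
    and seg_e: "image_mset seg_e (reflect c) = image_mset uminus (image_mset seg_b c)"
    if "multisegment c" for c
    using that by (auto simp: reflect_def multiset.map_comp comp_def multisegment_def
        seg_b_image_uminus seg_e_image_uminus intro!: image_mset_cong)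
  have count_uminus: "count (image_mset uminus A) x = count A (- x)" for A :: "int multiset" and x
    
    by (induction A) auto
  \<comment> \<open>The second use keeps the beginnings of \<open>reflect a'\<close>, which are the
    negated ends of \<open>a'\<close>.\<close>
  have ends: "image_mset seg_e ?asym = image_mset seg_e a'"
    using a''(1,2) a'(1) by (simp add: seg_e seg_b multiset.map_comp comp_def)
  have "symmetric ?asym"
    unfolding symmetric_def
  proof (intro conjI impI)
    show "multisegment ?asym"
      using a''(1) by simp
    show "\<forall>x. count (image_mset seg_b ?asym) x \<le> 1"
      using a''(1,3) by (simp add: seg_b count_uminus)
    show "\<forall>x. count (image_mset seg_e ?asym) x \<le> 1"
      using a'(2) by (simp add: ends)
    assume "?asym \<noteq> {#}"
    \<comment> \<open>Both sides change sign and trade places, so this is \<open>le\<close> for the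
      reflected pair in the opposite order.\<close>
    moreover have "seg_b \<Delta> \<le> seg_e \<Delta>'" if "\<Delta> \<in># ?asym" "\<Delta>' \<in># ?asym" for \<Delta> \<Delta>'
      using that le a''(1)
      by (auto simp: reflect_def multisegment_def seg_b_image_uminus seg_e_image_uminus)
    ultimately show "Max (seg_b ` set_mset ?asym) \<le> Min (seg_e ` set_mset ?asym)"
      by simp
  qed
  moreover have "multisegment (mset \<Gamma>s)" "multisegment {#}" "multisegment (mset ?C3)"
    using \<Gamma>s(1) \<Theta>s(1) by (auto simp: multisegment_def)
  moreover have "?asym \<in> S_by C2 C3 ?asym C1 \<and> a = trunc_by C2 C3 ?asym C1"
    if C: "right_listing (mset \<Gamma>s) C1" "left_listing {#} C2" "left_listing (mset ?C3) C3" for C1 C2 C3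
  proof -
    have "sorted_wrt (\<lambda>x y. seg_e x \<le> seg_e y) C1"
      using C(1) unfolding right_listing_def
      by (auto elim!: sorted_wrt_mono_rel[rotated] simp: seg_le_def seg_less_def)
    then have [simp]: "C1 = \<Gamma>s"
      using C(1) \<Gamma>s(2) by (intro sorted_key_unique) (auto simp: right_listing_def)
    have [simp]: "C2 = []"
      using C(2) by (simp add: left_listing_def)
    have "sorted_wrt (\<lambda>x y. seg_b x < seg_b y) ?C3"
      unfolding sorted_wrt_rev sorted_wrt_map
      by (rule sorted_wrt_mono_rel[OF _ \<Theta>s(2)]) (use \<Theta>s(1) in \<open>simp add: seg_b_image_uminus\<close>)
    then have [simp]: "C3 = ?C3"
      using C(3) by (intro sorted_key_unique) (auto simp: left_listing_def)
    have "ltrunc_by ?C3 ?asym = a'"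
      using rtrunc_seq_reflect[of ?asym "index_seq ?C3"] a''(1) right'(2)
      unfolding map_uminus_rev_index_seq[OF \<Theta>s(1)] ltrunc_by_def rtrunc_by_def
      by (metis multisegment_reflect reflect_reflect)
    moreover have "?asym \<in> S_left_by ?C3 ?asym"
      using reflect_self_S_right_seq_iff[of ?asym "index_seq ?C3"] a''(1) right'(1)
      unfolding map_uminus_rev_index_seq[OF \<Theta>s(1)] S_left_by_def S_right_by_def by simp
    ultimately show ?thesis
      using right by (simp add: S_by_def trunc_by_def S_left_by_def[of "[]"] ltrunc_by_def[of "[]"]
          index_seq_def[of "[]"] S_left_seq_def[of "[]"] ltrunc_seq_def[of "[]"])
  qed
  ultimately show ?thesis
    by blast
qed

end
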